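(* Let $q\in\mathbb{C}$ with $|q|<1$, let $k\ge1$ be an integer, and let $a,b,\gamma,t,x,y$ and $\alpha_j,\beta_j,u_j,v_j$ ($1\le j\le k$) be complex numbers. For $\max_{j\in\{1,\ldots,k\}}\{|xt|,|yt|,|xu_j|,|xv_j|,|yu_j|,|yv_j|\}<1$, we have $$\sum_{n_1,\ldots,n_k=0}^\infty\frac{\Phi_{n_1}^{(\alpha_1,\beta_1)}(u_1,v_1|q)\cdots\Phi_{n_k}^{(\alpha_k,\beta_k)}(u_k,v_k|q)}{(q;q)_{n_1}\cdots(q;q)_{n_k}}\int_x^y z^{n_1+\cdots+n_k}\frac{(qz/x,qz/y,\gamma zt;q)_\infty}{(bz/x,az/y,zt;q)_\infty}\,d_qz$$ $$=\int_x^y\frac{(qz/x,qz/y,\gamma zt,\alpha_1u_1z,\beta_1v_1z,\ldots,\alpha_ku_kz,\beta_kv_kz;q)_\infty}{(bz/x,az/y,zt,zu_1,zv_1,\ldots,zu_k,zv_k;q)_\infty}\,d_qz.$$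
   Context: For $a\in\mathbb{C}$: $(a;q)_0=1$, $(a;q)_n=\prod_{i=0}^{n-1}(1-aq^i)$, $(a;q)_\infty=\prod_{i=0}^\infty(1-aq^i)$, and $(a_1,\ldots,a_m;q)_n=(a_1;q)_n\cdots(a_m;q)_n$ for $n$ a nonnegative integer or $\infty$. The $q$-binomial coefficient is ${n\brack k}_q=\frac{(q;q)_n}{(q;q)_k(q;q)_{n-k}}$, and $\Phi_n^{(\alpha,\beta)}(x,y|q)=\sum_{k=0}^n {n\brack k}_q(\alpha;q)_k(\beta;q)_{n-k}x^ky^{n-k}$. The Jackson $q$-integral is $\int_a^b f(z)\,d_qz=(1-q)\sum_{n=0}^\infty[bf(bq^n)-af(aq^n)]q^n$. *)

theory Defs
  imports "HOL-Analysis.Analysis"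
begin

definition qpoch :: "complex \<Rightarrow> complex \<Rightarrow> nat \<Rightarrow> complex" where
  "qpoch a q n = (\<Prod>i<n. 1 - a * q ^ i)"

text \<open>The library's \<^const>\<open>prodinf\<close> takes the value 0, rather than being undefined, when some
  factor vanishes and the remaining ones have a convergent product; for \<open>norm q < 1\<close> the product
  below therefore always has its intended value.\<close>

definition qpoch_inf :: "complex \<Rightarrow> complex \<Rightarrow> complex" where
  "qpoch_inf a q = prodinf (\<lambda>i. 1 - a * q ^ i)"

definition qpochs_inf :: "complex list \<Rightarrow> complex \<Rightarrow> complex" where
  "qpochs_inf as q = (\<Prod>a\<leftarrow>as. qpoch_inf a q)"

definition qbinomial :: "complex \<Rightarrow> nat \<Rightarrow> nat \<Rightarrow> complex" where
  "qbinomial q n k = qpoch q q n / (qpoch q q k * qpoch q q (n - k))"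

definition Phi :: "complex \<Rightarrow> complex \<Rightarrow> complex \<Rightarrow> nat \<Rightarrow> complex \<Rightarrow> complex \<Rightarrow> complex" where
  "Phi q \<alpha> \<beta> n x y =
     (\<Sum>k\<le>n. qbinomial q n k * qpoch \<alpha> q k * qpoch \<beta> q (n - k) * x ^ k * y ^ (n - k))"

definition jackson_term ::
    "complex \<Rightarrow> complex \<Rightarrow> complex \<Rightarrow> (complex \<Rightarrow> complex) \<Rightarrow> nat \<Rightarrow> complex" where
  "jackson_term q a b f n = (b * f (b * q ^ n) - a * f (a * q ^ n)) * q ^ n"

definition jackson_integrable ::
    "complex \<Rightarrow> complex \<Rightarrow> complex \<Rightarrow> (complex \<Rightarrow> complex) \<Rightarrow> bool" where
  "jackson_integrable q a b f \<longleftrightarrow> summable (jackson_term q a b f)"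

definition jackson_integral ::
    "complex \<Rightarrow> complex \<Rightarrow> complex \<Rightarrow> (complex \<Rightarrow> complex) \<Rightarrow> complex" where
  "jackson_integral q a b f = (1 - q) * (\<Sum>n. jackson_term q a b f n)"

end

theory Submission
  imports Defs
begin

text \<open>
  The identity is a termwise integration. By the \<open>q\<close>-binomial theorem the coefficients
  \<open>(\<alpha>;q)\<^sub>i / (q;q)\<^sub>i\<close> have the generating function \<open>(\<alpha>w;q)\<^sub>\<infinity> / (w;q)\<^sub>\<infinity>\<close>, and
  \<open>\<Phi>\<^sub>n / (q;q)\<^sub>n\<close> is the Cauchy convolution of two such coefficient sequences; hence
  \<open>\<Sum>\<^sub>n \<Phi>\<^sub>n(u,v) z\<^sup>n / (q;q)\<^sub>n = (\<alpha>uz, \<beta>vz;q)\<^sub>\<infinity> / (uz, vz;q)\<^sub>\<infinity>\<close> whenever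
  \<open>|uz|, |vz| < 1\<close> (lemma \<open>Phi_generating_function\<close>). Multiplying \<open>k\<close> of these absolutely
  convergent series gives a series over multi-indices whose sum is exactly the factor by which
  the two integrands differ (lemma \<open>prod_Phi_generating_function\<close>).

  It remains to exchange the sum over multi-indices with the Jackson integral, which is itself a
  pair of series, one along \<open>x q\<^sup>m\<close> and one along \<open>y q\<^sup>m\<close>
  (lemma \<open>jackson_integral_generating_function\<close>). The double series converges absolutely: since
  \<open>|w q\<^sup>m| \<le> |w|\<close>, the power series is dominated by its value at the endpoint \<open>w\<close>, the
  Jackson weights contribute the geometric factor \<open>q\<^sup>m\<close>, and the kernel \<open>f\<close> is bounded along
  \<open>w q\<^sup>m\<close>. The kernel is bounded there because every factor
  \<open>(r q\<^sup>m;q)\<^sub>\<infinity>\<close> tends to \<open>1\<close>, so \<open>f(w q\<^sup>m) \<rightarrow> 1\<close>, and the finitely many points at which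
  a denominator may vanish, where the quotient is \<open>0\<close> by the convention \<open>c / 0 = 0\<close>, do not
  affect this limit.
\<close>

section \<open>Limits of \<open>q\<close>-Pochhammer symbols\<close>

text \<open>This estimate is uniform in \<open>n\<close> and tends to \<open>0\<close> with \<open>a\<close>, so it carries over to the
  infinite product and gives the continuity of \<open>(a;q)\<^sub>\<infinity>\<close> at \<open>a = 0\<close>.\<close>

lemma norm_qpoch_minus_1_le:
  assumes "norm q < 1"
  shows "norm (qpoch a q n - 1) \<le> exp (norm a / (1 - norm q)) - 1"
proof -
  have "norm (qpoch a q n - 1) \<le> (\<Prod>i<n. 1 + norm (- a * q ^ i)) - 1"
    using norm_prod_minus1_le_prod_minus1[of "\<lambda>i. - a * q ^ i" "{..<n}"]
    by (simp add: qpoch_def)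
  also have "(\<Prod>i<n. 1 + norm (- a * q ^ i)) \<le> exp (\<Sum>i<n. norm (- a * q ^ i))"
    by (rule prod_le_exp_sum) auto
  also have "(\<Sum>i<n. norm (- a * q ^ i)) \<le> (\<Sum>i. norm a * norm q ^ i)"
    unfolding norm_mult norm_minus_cancel norm_power
    by (intro sum_le_suminf summable_mult summable_geometric) (use assms in auto)
  also have "\<dots> = norm a / (1 - norm q)"
    using assms by (simp add: suminf_mult suminf_geometric)
  finally show ?thesis
    by simp
qed

lemma convergent_prod_qpoch:
  fixes a q :: complex
  assumes "norm q < 1"
  shows "convergent_prod (\<lambda>i. 1 - a * q ^ i)"
proof -
  have "summable (\<lambda>i. norm a * norm q ^ i)"
    by (intro summable_mult summable_geometric) (use assms in auto)
  then have "abs_convergent_prod (\<lambda>i. 1 - a * q ^ i)"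
    by (simp add: abs_convergent_prod_conv_summable norm_mult norm_power)
  then show ?thesis
    by (rule abs_convergent_prod_imp_convergent_prod)
qed

lemma qpoch_tendsto_qpoch_inf:
  assumes "norm q < 1"
  shows "(\<lambda>n. qpoch a q n) \<longlonglongrightarrow> qpoch_inf a q"
proof -
  have "(\<lambda>n. qpoch a q (Suc n)) \<longlonglongrightarrow> qpoch_inf a q"
    using convergent_prod_LIMSEQ[OF convergent_prod_qpoch[OF assms, of a]]
    by (simp add: qpoch_def qpoch_inf_def lessThan_Suc_atMost)
  then show ?thesis
    by (rule LIMSEQ_imp_Suc)
qed

lemma qpoch_inf_0 [simp]: "qpoch_inf 0 q = 1"
  by (simp add: qpoch_inf_def)

lemma norm_qpoch_inf_minus_1_le:
  assumes "norm q < 1"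
  shows "norm (qpoch_inf a q - 1) \<le> exp (norm a / (1 - norm q)) - 1"
proof (rule tendsto_upperbound)
  show "(\<lambda>n. norm (qpoch a q n - 1)) \<longlonglongrightarrow> norm (qpoch_inf a q - 1)"
    by (intro tendsto_intros qpoch_tendsto_qpoch_inf assms)
qed (simp_all add: norm_qpoch_minus_1_le assms)

lemma qpoch_inf_tendsto_1:
  assumes "norm q < 1" and "(w \<longlongrightarrow> 0) F"
  shows "((\<lambda>n. qpoch_inf (w n) q) \<longlongrightarrow> 1) F"
proof -
  have "((\<lambda>n. exp (norm (w n) / (1 - norm q)) - 1) \<longlongrightarrow> exp (norm (0::complex) / (1 - norm q)) - 1) F"
    by (intro tendsto_intros assms) (use assms in auto)
  then have "((\<lambda>n. exp (norm (w n) / (1 - norm q)) - 1) \<longlongrightarrow> 0) F"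
    by simp
  then have "((\<lambda>n. qpoch_inf (w n) q - 1) \<longlongrightarrow> 0) F"
    by (rule Lim_null_comparison[rotated])
       (intro always_eventually allI norm_qpoch_inf_minus_1_le assms(1))
  then show ?thesis
    by (simp add: LIM_zero_iff)
qed

lemma one_minus_mult_power_neq_0:
  fixes a q :: complex
  assumes "norm q < 1" "norm a < 1"
  shows "1 - a * q ^ i \<noteq> 0"
proof -
  have "norm a * norm q ^ i \<le> norm a * 1"
    by (intro mult_left_mono power_le_one) (use assms in auto)
  then have "norm (a * q ^ i) < 1"
    using assms by (simp add: norm_mult norm_power)
  then show ?thesis
    by auto
qed

lemma qpoch_neq_0: "norm q < 1 \<Longrightarrow> norm a < 1 \<Longrightarrow> qpoch a q n \<noteq> 0"
  using one_minus_mult_power_neq_0 by (simp add: qpoch_def)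

lemma qpoch_inf_neq_0: "norm q < 1 \<Longrightarrow> norm a < 1 \<Longrightarrow> qpoch_inf a q \<noteq> 0"
  unfolding qpoch_inf_def
  by (rule prodinf_nonzero[OF convergent_prod_qpoch one_minus_mult_power_neq_0])

section \<open>The \<open>q\<close>-binomial theorem\<close>

text \<open>The coefficients converge to \<open>(a;q)\<^sub>\<infinity> / (q;q)\<^sub>\<infinity>\<close>, hence are bounded, and the geometric
  series dominates.\<close>

lemma summable_norm_q_binomial_series:
  assumes "norm q < 1" "norm z < 1"
  shows "summable (\<lambda>n. norm (qpoch a q n / qpoch q q n * z ^ n))"
proof -
  have "(\<lambda>n. qpoch a q n / qpoch q q n) \<longlonglongrightarrow> qpoch_inf a q / qpoch_inf q q"
    by (intro tendsto_divide qpoch_tendsto_qpoch_inf qpoch_inf_neq_0 assms)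
  then have "Bseq (\<lambda>n. qpoch a q n / qpoch q q n)"
    by (intro convergent_imp_Bseq convergentI)
  then obtain B where B: "\<And>n. norm (qpoch a q n / qpoch q q n) \<le> B"
    by (auto simp: Bseq_def)
  show ?thesis
  proof (rule summable_comparison_test')
    show "summable (\<lambda>n. B * norm z ^ n)"
      using assms by (intro summable_mult summable_geometric) auto
    show "norm (norm (qpoch a q n / qpoch q q n * z ^ n)) \<le> B * norm z ^ n" for n
      using mult_right_mono[OF B[of n], of "norm z ^ n"] by (simp add: norm_mult norm_divide norm_power)
  qed
qed

text \<open>The recurrence of the coefficients says that the sum \<open>F\<close> of the series satisfies
  \<open>(1 - w) F(w) = (1 - a w) F(w q)\<close>. Iterating this from \<open>z\<close> and letting \<open>z q\<^sup>n \<rightarrow> 0\<close>, where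
  \<open>F\<close> is continuous with \<open>F(0) = 1\<close>, produces the two infinite products.\<close>

theorem q_binomial_theorem:
  assumes q: "norm q < 1" and z: "norm z < 1"
  shows "(\<lambda>n. qpoch a q n / qpoch q q n * z ^ n) sums (qpoch_inf (a * z) q / qpoch_inf z q)"
proof -
  define c where "c = (\<lambda>n. qpoch a q n / qpoch q q n)"
  define F where "F = (\<lambda>w. \<Sum>n. c n * w ^ n)"
  have summ: "summable (\<lambda>n. c n * w ^ n)" if "norm w < 1" for w
    unfolding c_def by (rule summable_norm_cancel, rule summable_norm_q_binomial_series[OF q that])
  have c_Suc: "c (Suc n) * (1 - q ^ Suc n) = c n * (1 - a * q ^ n)" for n
    using qpoch_neq_0[OF q q, of n] one_minus_mult_power_neq_0[OF q q, of n]
    by (simp add: c_def qpoch_def field_simps)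
  have feq: "(1 - w) * F w = (1 - a * w) * F (w * q)" if w: "norm w < 1" for w
  proof -
    have wq: "norm (w * q) < 1"
      using mult_strict_mono[OF w q] by (cases "w = 0") (auto simp: norm_mult)
    have "(\<lambda>n. c n * w ^ n - c n * (w * q) ^ n) sums (F w - F (w * q))"
      unfolding F_def by (intro sums_diff summable_sums summ w wq)
    then have "(\<lambda>n. c (Suc n) * w ^ Suc n - c (Suc n) * (w * q) ^ Suc n) sums (F w - F (w * q))"
      by (subst sums_Suc_iff) simp
    also have "(\<lambda>n. c (Suc n) * w ^ Suc n - c (Suc n) * (w * q) ^ Suc n)
        = (\<lambda>n. w * (c n * w ^ n - a * (c n * (w * q) ^ n)))"
    proof
      fix n
      have "c (Suc n) * w ^ Suc n - c (Suc n) * (w * q) ^ Suc n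
          = c (Suc n) * (1 - q ^ Suc n) * w ^ Suc n"
        by (simp add: algebra_simps power_mult_distrib)
      then show "c (Suc n) * w ^ Suc n - c (Suc n) * (w * q) ^ Suc n
          = w * (c n * w ^ n - a * (c n * (w * q) ^ n))"
        unfolding c_Suc by (simp add: algebra_simps power_mult_distrib)
    qed
    finally have "(\<lambda>n. w * (c n * w ^ n - a * (c n * (w * q) ^ n))) sums (F w - F (w * q))" .
    moreover have "(\<lambda>n. w * (c n * w ^ n - a * (c n * (w * q) ^ n)))
        sums (w * (F w - a * F (w * q)))"
      unfolding F_def by (intro sums_mult sums_diff summable_sums summ w wq)
    ultimately have "F w - F (w * q) = w * (F w - a * F (w * q))"
      by (rule sums_unique2)
    then show ?thesis
      by (simp add: algebra_simps)
  qed
  have norm_zq: "norm (z * q ^ n) < 1" for n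
    using mult_mono[of "norm z" "norm z" "norm q ^ n" 1] q z
    by (simp add: norm_mult norm_power power_le_one)
  have iter: "qpoch z q n * F z = qpoch (a * z) q n * F (z * q ^ n)" for n
  proof (induction n)
    case (Suc n)
    have "qpoch z q (Suc n) * F z = (1 - z * q ^ n) * (qpoch z q n * F z)"
      by (simp add: qpoch_def mult_ac)
    also have "\<dots> = qpoch (a * z) q n * ((1 - z * q ^ n) * F (z * q ^ n))"
      by (simp add: Suc.IH)
    also have "\<dots> = qpoch (a * z) q n * ((1 - a * (z * q ^ n)) * F (z * q ^ n * q))"
      by (simp only: feq[OF norm_zq])
    also have "\<dots> = qpoch (a * z) q (Suc n) * F (z * q ^ Suc n)"
      by (simp add: qpoch_def mult_ac)
    finally show ?case .
  qed (simp add: qpoch_def)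
  \<comment> \<open>Any radius in \<open>(0, 1)\<close> serves here; \<open>z\<close> itself may be \<open>0\<close>.\<close>
  have "isCont F 0"
    unfolding F_def by (rule isCont_powser[of _ "1/2"]) (auto intro: summ)
  moreover have "(\<lambda>n. z * q ^ n) \<longlonglongrightarrow> 0"
    by (intro tendsto_mult_right_zero LIMSEQ_power_zero q)
  ultimately have "(\<lambda>n. F (z * q ^ n)) \<longlonglongrightarrow> F 0"
    by (rule isCont_tendsto_compose)
  moreover have "F 0 = 1"
    unfolding F_def powser_zero by (simp add: c_def qpoch_def)
  ultimately have "(\<lambda>n. qpoch (a * z) q n * F (z * q ^ n)) \<longlonglongrightarrow> qpoch_inf (a * z) q * 1"
    by (intro tendsto_mult qpoch_tendsto_qpoch_inf q) simp
  moreover have "(\<lambda>n. qpoch z q n * F z) \<longlonglongrightarrow> qpoch_inf z q * F z"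
    by (intro tendsto_intros qpoch_tendsto_qpoch_inf q)
  ultimately have "qpoch_inf z q * F z = qpoch_inf (a * z) q"
    unfolding iter using LIMSEQ_unique by fastforce
  then have "F z = qpoch_inf (a * z) q / qpoch_inf z q"
    using qpoch_inf_neq_0[OF q z] by (simp add: field_simps)
  then show ?thesis
    using summable_sums[OF summ[OF z]] unfolding F_def c_def by simp
qed

section \<open>Generating functions of the polynomials \<open>\<Phi>\<^sub>n\<close>\<close>

text \<open>The factor \<open>(q;q)\<^sub>n\<close> of the \<open>q\<close>-binomial coefficient cancels, which leaves the Cauchy
  convolution of two \<open>q\<close>-binomial series.\<close>

lemma Phi_generating_term:
  assumes "norm q < 1"
  shows "Phi q \<alpha> \<beta> n u v / qpoch q q n * z ^ n =
    (\<Sum>i\<le>n. (qpoch \<alpha> q i / qpoch q q i * (u * z) ^ i) *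
             (qpoch \<beta> q (n - i) / qpoch q q (n - i) * (v * z) ^ (n - i)))"
  unfolding Phi_def sum_divide_distrib sum_distrib_right
proof (rule sum.cong)
  fix i assume "i \<in> {..n}"
  then have z: "z ^ n = z ^ i * z ^ (n - i)"
    by (simp flip: power_add)
  show "qbinomial q n i * qpoch \<alpha> q i * qpoch \<beta> q (n - i) * u ^ i * v ^ (n - i) / qpoch q q n * z ^ n
      = (qpoch \<alpha> q i / qpoch q q i * (u * z) ^ i) *
        (qpoch \<beta> q (n - i) / qpoch q q (n - i) * (v * z) ^ (n - i))"
    using qpoch_neq_0[OF assms assms] unfolding z
    by (simp add: qbinomial_def power_mult_distrib)
qed simp

lemma
  assumes q: "norm q < 1" and u: "norm (u * z) < 1" and v: "norm (v * z) < 1"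
  shows summable_norm_Phi_generating:
      "summable (\<lambda>n. norm (Phi q \<alpha> \<beta> n u v / qpoch q q n * z ^ n))" (is ?S)
    and Phi_generating_function:
      "(\<lambda>n. Phi q \<alpha> \<beta> n u v / qpoch q q n * z ^ n) sums
         (qpochs_inf [\<alpha> * u * z, \<beta> * v * z] q / qpochs_inf [z * u, z * v] q)" (is ?G)
proof -
  let ?A = "\<lambda>i. qpoch \<alpha> q i / qpoch q q i * (u * z) ^ i"
  let ?B = "\<lambda>i. qpoch \<beta> q i / qpoch q q i * (v * z) ^ i"
  note abs = summable_norm_q_binomial_series[OF q u, of \<alpha>]
    summable_norm_q_binomial_series[OF q v, of \<beta>]
  show ?S
  proof (rule summable_comparison_test')
    show "summable (\<lambda>n. \<Sum>i\<le>n. norm (?A i) * norm (?B (n - i)))"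
      by (rule summable_Cauchy_product) (simp_all only: real_norm_def abs_norm_cancel abs)
    show "norm (norm (Phi q \<alpha> \<beta> n u v / qpoch q q n * z ^ n))
        \<le> (\<Sum>i\<le>n. norm (?A i) * norm (?B (n - i)))" for n
      unfolding Phi_generating_term[OF q] real_norm_def abs_norm_cancel norm_mult[symmetric]
      by (rule norm_sum)
  qed
  have "(\<lambda>n. Phi q \<alpha> \<beta> n u v / qpoch q q n * z ^ n) sums ((\<Sum>i. ?A i) * (\<Sum>i. ?B i))"
    unfolding Phi_generating_term[OF q] by (rule Cauchy_product_sums[OF abs])
  also have "(\<Sum>i. ?A i) * (\<Sum>i. ?B i)
      = qpochs_inf [\<alpha> * u * z, \<beta> * v * z] q / qpochs_inf [z * u, z * v] q"
    using q_binomial_theorem[OF q u, of \<alpha>] q_binomial_theorem[OF q v, of \<beta>]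
    by (simp add: sums_iff qpochs_inf_def mult_ac)
  finally show ?G .
qed

lemma
  fixes f :: "'a \<Rightarrow> nat \<Rightarrow> complex"
  assumes A: "finite A" and summ: "\<And>j. j \<in> A \<Longrightarrow> summable (\<lambda>n. norm (f j n))"
  shows summable_norm_prod_PiE:
      "(\<lambda>n. norm (\<Prod>j\<in>A. f j (n j))) summable_on (A \<rightarrow>\<^sub>E UNIV)"
    and has_sum_prod_PiE:
      "((\<lambda>n. \<Prod>j\<in>A. f j (n j)) has_sum (\<Prod>j\<in>A. \<Sum>n. f j n)) (A \<rightarrow>\<^sub>E UNIV)"
proof -
  have abs: "(\<lambda>n. norm (f j n)) summable_on UNIV" if "j \<in> A" for j
    using summ[OF that] by (intro norm_summable_imp_summable_on) simp
  show S: "(\<lambda>n. norm (\<Prod>j\<in>A. f j (n j))) summable_on (A \<rightarrow>\<^sub>E UNIV)"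
    unfolding abs_summable_equivalent
    by (rule abs_summable_on_prod_PiE) (use A abs in \<open>simp_all flip: abs_summable_equivalent\<close>)
  have "(\<Prod>j\<in>A. \<Sum>n. f j n) = (\<Prod>j\<in>A. \<Sum>\<^sub>\<infinity>n. f j n)"
  proof (rule prod.cong)
    fix j assume "j \<in> A"
    then have "(f j has_sum (\<Sum>n. f j n)) UNIV"
      using summ summable_norm_cancel by (intro norm_summable_imp_has_sum summable_sums) blast+
    then show "(\<Sum>n. f j n) = (\<Sum>\<^sub>\<infinity>n. f j n)"
      by (simp add: infsumI)
  qed simp
  also have "\<dots> = (\<Sum>\<^sub>\<infinity>n\<in>A \<rightarrow>\<^sub>E UNIV. \<Prod>j\<in>A. f j (n j))"
    using A abs by (rule infsum_prod_PiE_abs[symmetric])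
  finally show "((\<lambda>n. \<Prod>j\<in>A. f j (n j)) has_sum (\<Prod>j\<in>A. \<Sum>n. f j n)) (A \<rightarrow>\<^sub>E UNIV)"
    using abs_summable_summable[OF S] by simp
qed

lemma
  fixes u v :: "'a \<Rightarrow> complex"
  assumes q: "norm q < 1" and A: "finite A"
    and u: "\<And>j. j \<in> A \<Longrightarrow> norm (u j * z) < 1" and v: "\<And>j. j \<in> A \<Longrightarrow> norm (v j * z) < 1"
  shows summable_norm_prod_Phi_generating:
    "(\<lambda>n. norm ((\<Prod>j\<in>A. Phi q (\<alpha> j) (\<beta> j) (n j) (u j) (v j)) / (\<Prod>j\<in>A. qpoch q q (n j))
        * z ^ (\<Sum>j\<in>A. n j))) summable_on (A \<rightarrow>\<^sub>E UNIV)"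
    and prod_Phi_generating_function:
    "((\<lambda>n. (\<Prod>j\<in>A. Phi q (\<alpha> j) (\<beta> j) (n j) (u j) (v j)) / (\<Prod>j\<in>A. qpoch q q (n j))
        * z ^ (\<Sum>j\<in>A. n j)) has_sum
      ((\<Prod>j\<in>A. qpochs_inf [\<alpha> j * u j * z, \<beta> j * v j * z] q)
        / (\<Prod>j\<in>A. qpochs_inf [z * u j, z * v j] q))) (A \<rightarrow>\<^sub>E UNIV)"
proof -
  let ?f = "\<lambda>j n. Phi q (\<alpha> j) (\<beta> j) n (u j) (v j) / qpoch q q n * z ^ n"
  have split: "(\<Prod>j\<in>A. Phi q (\<alpha> j) (\<beta> j) (n j) (u j) (v j)) / (\<Prod>j\<in>A. qpoch q q (n j))
      * z ^ (\<Sum>j\<in>A. n j) = (\<Prod>j\<in>A. ?f j (n j))" for n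
    by (simp add: prod.distrib prod_dividef power_sum)
  have S: "summable (\<lambda>n. norm (?f j n))" if "j \<in> A" for j
    by (intro summable_norm_Phi_generating q u v that)
  have sums: "(\<Prod>j\<in>A. \<Sum>n. ?f j n) = (\<Prod>j\<in>A. qpochs_inf [\<alpha> j * u j * z, \<beta> j * v j * z] q)
        / (\<Prod>j\<in>A. qpochs_inf [z * u j, z * v j] q)"
    unfolding prod_dividef[symmetric]
    by (intro prod.cong refl sums_unique[symmetric] Phi_generating_function q u v)
  show "(\<lambda>n. norm ((\<Prod>j\<in>A. Phi q (\<alpha> j) (\<beta> j) (n j) (u j) (v j)) / (\<Prod>j\<in>A. qpoch q q (n j))
        * z ^ (\<Sum>j\<in>A. n j))) summable_on (A \<rightarrow>\<^sub>E UNIV)"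
    unfolding split by (rule summable_norm_prod_PiE[OF A S])
  show "((\<lambda>n. (\<Prod>j\<in>A. Phi q (\<alpha> j) (\<beta> j) (n j) (u j) (v j)) / (\<Prod>j\<in>A. qpoch q q (n j))
        * z ^ (\<Sum>j\<in>A. n j)) has_sum
      ((\<Prod>j\<in>A. qpochs_inf [\<alpha> j * u j * z, \<beta> j * v j * z] q)
        / (\<Prod>j\<in>A. qpochs_inf [z * u j, z * v j] q))) (A \<rightarrow>\<^sub>E UNIV)"
    unfolding split sums[symmetric] by (rule has_sum_prod_PiE[OF A S])
qed

section \<open>Termwise Jackson integration\<close>

lemma summable_norm_Bseq_geometric:
  fixes h :: "nat \<Rightarrow> complex"
  assumes "norm q < 1" "Bseq h"
  shows "summable (\<lambda>m. norm (h m * q ^ m))"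
proof -
  obtain B where B: "\<And>m. norm (h m) \<le> B"
    using assms(2) by (auto simp: Bseq_def)
  show ?thesis
  proof (rule summable_comparison_test')
    show "summable (\<lambda>m. B * norm q ^ m)"
      using assms by (intro summable_mult summable_geometric) auto
    show "norm (norm (h m * q ^ m)) \<le> B * norm q ^ m" for m
      using mult_right_mono[OF B[of m], of "norm q ^ m"] by (simp add: norm_mult norm_power)
  qed
qed

lemma summable_norm_endpoint_series:
  fixes h :: "nat \<Rightarrow> complex"
  assumes q: "norm q < 1" and h: "Bseq h"
  shows "summable (\<lambda>m. norm ((w * q ^ m) ^ N * h m * q ^ m))"
proof -
  have "(\<lambda>m. (w * q ^ m) ^ N) \<longlonglongrightarrow> (w * 0) ^ N"
    by (intro tendsto_intros LIMSEQ_power_zero q)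
  then have "Bseq (\<lambda>m. (w * q ^ m) ^ N)"
    by (intro convergent_imp_Bseq convergentI)
  then show ?thesis
    by (intro summable_norm_Bseq_geometric q Bseq_mult h)
qed

text \<open>One endpoint \<open>w\<close> of the Jackson integral, with \<open>h m\<close> in the role of \<open>f(w q\<^sup>m)\<close>. The
  double family over \<open>(i, m)\<close> is dominated by the product of the summable families
  \<open>c\<^sub>i w\<^bsup>d i\<^esup>\<close> and \<open>h\<^sub>m q\<^sup>m\<close>, so it may be summed in either order.\<close>

lemma
  fixes c :: "'i \<Rightarrow> complex" and d :: "'i \<Rightarrow> nat" and h :: "nat \<Rightarrow> complex"
  assumes q: "norm q < 1" and h: "Bseq h"
    and abs: "(\<lambda>i. norm (c i * w ^ d i)) summable_on A"
    and G: "\<And>m. ((\<lambda>i. c i * (w * q ^ m) ^ d i) has_sum G m) A"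
  shows summable_endpoint_generating: "summable (\<lambda>m. G m * h m * q ^ m)" (is ?S)
    and has_sum_endpoint_interchange:
      "((\<lambda>i. c i * (\<Sum>m. (w * q ^ m) ^ d i * h m * q ^ m)) has_sum (\<Sum>m. G m * h m * q ^ m)) A"
      (is ?I)
proof -
  define T where "T = (\<lambda>(i, m). c i * ((w * q ^ m) ^ d i * h m * q ^ m))"
  let ?b = "\<lambda>(i, m). norm (c i * w ^ d i) * norm (h m * q ^ m)"
  have hq: "summable (\<lambda>m. norm (h m * q ^ m))"
    by (rule summable_norm_Bseq_geometric[OF q h])
  have "?b summable_on A \<times> UNIV"
  proof (rule summable_on_SigmaI)
    show "((\<lambda>m. ?b (i, m)) has_sum norm (c i * w ^ d i) * (\<Sum>m. norm (h m * q ^ m))) UNIV" for i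
      unfolding prod.case using hq
      by (intro has_sum_cmult_right norm_summable_imp_has_sum summable_sums) simp_all
  qed (use abs in \<open>auto intro: summable_on_cmult_left\<close>)
  then have "(\<lambda>p. norm (T p)) summable_on A \<times> UNIV"
  proof (rule Infinite_Sum.abs_summable_on_comparison_test')
    fix p assume "p \<in> A \<times> (UNIV :: nat set)"
    obtain i m where p: "p = (i, m)" by (cases p)
    have "T p = (q ^ m) ^ d i * ((c i * w ^ d i) * (h m * q ^ m))"
      by (simp add: p T_def power_mult_distrib)
    then have "norm (T p) = norm q ^ (m * d i) * ?b p"
      by (simp add: p norm_mult norm_power power_mult)
    also have "\<dots> \<le> 1 * ?b p"
      by (intro mult_right_mono power_le_one) (use q in \<open>auto simp: p\<close>)
    finally show "norm (T p) \<le> ?b p" by simp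
  qed
  then have "T summable_on A \<times> UNIV"
    by (rule abs_summable_summable)
  then obtain S where S: "(T has_sum S) (A \<times> UNIV)"
    by (auto simp: summable_on_def)
  then have "((\<lambda>(m, i). T (i, m)) has_sum S) (UNIV \<times> A)"
    by (subst (asm) has_sum_swap)
  then have "((\<lambda>m. G m * h m * q ^ m) has_sum S) UNIV"
  proof (rule has_sum_SigmaD)
    show "((\<lambda>i. case (m, i) of (m, i) \<Rightarrow> T (i, m)) has_sum G m * h m * q ^ m) A" for m
      using has_sum_cmult_left[OF G[of m], of "h m * q ^ m"] by (simp add: T_def mult.assoc)
  qed
  then have sums: "(\<lambda>m. G m * h m * q ^ m) sums S"
    by (rule has_sum_imp_sums)
  then show ?S
    by (rule sums_summable)
  have "((\<lambda>i. c i * (\<Sum>m. (w * q ^ m) ^ d i * h m * q ^ m)) has_sum S) A"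
    using S
  proof (rule has_sum_SigmaD)
    show "((\<lambda>m. T (i, m)) has_sum c i * (\<Sum>m. (w * q ^ m) ^ d i * h m * q ^ m)) UNIV" for i
      unfolding T_def prod.case using summable_norm_endpoint_series[OF q h]
      by (intro has_sum_cmult_right norm_summable_imp_has_sum summable_sums)
         (blast intro: summable_norm_cancel)+
  qed
  then show ?I
    using sums by (simp add: sums_iff)
qed

lemma jackson_term_split:
  "jackson_term q a b (\<lambda>z. F z * f z) =
    (\<lambda>m. b * (F (b * q ^ m) * f (b * q ^ m) * q ^ m) - a * (F (a * q ^ m) * f (a * q ^ m) * q ^ m))"
  by (simp add: jackson_term_def fun_eq_iff algebra_simps)

text \<open>The index set \<open>A\<close> is arbitrary and the exponents \<open>d i\<close> may repeat, which is what lets the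
  multi-indices \<open>(n\<^sub>1, \<dots>, n\<^sub>k)\<close> be used directly, with \<open>d\<close> their total degree.\<close>

theorem jackson_integral_generating_function:
  fixes c :: "'i \<Rightarrow> complex" and d :: "'i \<Rightarrow> nat"
  assumes q: "norm q < 1"
    and bounded: "\<And>w. w \<in> {x, y} \<Longrightarrow> Bseq (\<lambda>m. f (w * q ^ m))"
    and abs: "\<And>w. w \<in> {x, y} \<Longrightarrow> (\<lambda>i. norm (c i * w ^ d i)) summable_on A"
    and G: "\<And>w m. w \<in> {x, y} \<Longrightarrow> ((\<lambda>i. c i * (w * q ^ m) ^ d i) has_sum G (w * q ^ m)) A"
  shows "jackson_integrable q x y (\<lambda>z. z ^ N * f z)"
    and "jackson_integrable q x y (\<lambda>z. G z * f z)"
    and "((\<lambda>i. c i * jackson_integral q x y (\<lambda>z. z ^ d i * f z))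
           has_sum jackson_integral q x y (\<lambda>z. G z * f z)) A"
proof -
  define E where "E = (\<lambda>w N. \<Sum>m. (w * q ^ m) ^ N * f (w * q ^ m) * q ^ m)"
  define EG where "EG = (\<lambda>w. \<Sum>m. G (w * q ^ m) * f (w * q ^ m) * q ^ m)"
  have sumE: "(\<lambda>m. (w * q ^ m) ^ N * f (w * q ^ m) * q ^ m) sums E w N" if "w \<in> {x, y}" for w N
    unfolding E_def
    using summable_norm_cancel[OF summable_norm_endpoint_series[OF q bounded[OF that]]]
    by (rule summable_sums)
  have sumEG: "(\<lambda>m. G (w * q ^ m) * f (w * q ^ m) * q ^ m) sums EG w" if "w \<in> {x, y}" for w
    unfolding EG_def
    using summable_endpoint_generating[OF q bounded[OF that] abs[OF that] G[OF that]]
    by (rule summable_sums)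
  have JN: "jackson_term q x y (\<lambda>z. z ^ N * f z) sums (y * E y N - x * E x N)" for N
    unfolding jackson_term_split[where F = "\<lambda>z. z ^ N"] by (intro sums_diff sums_mult sumE) auto
  have JG: "jackson_term q x y (\<lambda>z. G z * f z) sums (y * EG y - x * EG x)"
    unfolding jackson_term_split by (intro sums_diff sums_mult sumEG) auto
  show "jackson_integrable q x y (\<lambda>z. z ^ N * f z)" "jackson_integrable q x y (\<lambda>z. G z * f z)"
    using JN JG by (auto simp: jackson_integrable_def sums_iff)
  have I: "((\<lambda>i. c i * E w (d i)) has_sum EG w) A" if "w \<in> {x, y}" for w
    unfolding E_def EG_def
    by (rule has_sum_endpoint_interchange[OF q bounded[OF that] abs[OF that] G[OF that]])
  have "((\<lambda>i. (1 - q) * (y * (c i * E y (d i)) + - x * (c i * E x (d i))))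
      has_sum (1 - q) * (y * EG y + - x * EG x)) A"
    by (intro has_sum_cmult_right has_sum_add I) auto
  moreover have "c i * jackson_integral q x y (\<lambda>z. z ^ d i * f z)
      = (1 - q) * (y * (c i * E y (d i)) + - x * (c i * E x (d i)))" for i
    unfolding jackson_integral_def sums_unique[OF JN, symmetric] by (simp add: algebra_simps)
  moreover have "jackson_integral q x y (\<lambda>z. G z * f z) = (1 - q) * (y * EG y + - x * EG x)"
    unfolding jackson_integral_def sums_unique[OF JG, symmetric] by simp
  ultimately show "((\<lambda>i. c i * jackson_integral q x y (\<lambda>z. z ^ d i * f z))
           has_sum jackson_integral q x y (\<lambda>z. G z * f z)) A"
    by simp
qed

lemma qpoch_inf_geometric_tendsto_1:
  assumes "norm q < 1"
  shows "(\<lambda>m. qpoch_inf (r * q ^ m) q) \<longlonglongrightarrow> 1"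
  using assms by (intro qpoch_inf_tendsto_1 tendsto_mult_right_zero LIMSEQ_power_zero)

theorem theorem5p4:
  fixes q a b \<gamma> t x y :: complex
    and k :: nat
    and \<alpha> \<beta> u v :: "nat \<Rightarrow> complex"
    and f g :: "complex \<Rightarrow> complex"
  defines "f \<equiv> \<lambda>z. qpochs_inf [q * z / x, q * z / y, \<gamma> * z * t] q
                  / qpochs_inf [b * z / x, a * z / y, z * t] q"
    and "g \<equiv> \<lambda>z. (qpochs_inf [q * z / x, q * z / y, \<gamma> * z * t] q
                    * (\<Prod>j=1..k. qpochs_inf [\<alpha> j * u j * z, \<beta> j * v j * z] q))
                  / (qpochs_inf [b * z / x, a * z / y, z * t] q
                    * (\<Prod>j=1..k. qpochs_inf [z * u j, z * v j] q))"
  assumes "norm q < 1" and "k \<ge> 1"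
    and "norm (x * t) < 1" and "norm (y * t) < 1"
    and "\<And>j. j \<in> {1..k} \<Longrightarrow>
           norm (x * u j) < 1 \<and> norm (x * v j) < 1 \<and> norm (y * u j) < 1 \<and> norm (y * v j) < 1"
  shows "(\<forall>N. jackson_integrable q x y (\<lambda>z. z ^ N * f z))
    \<and> jackson_integrable q x y g
    \<and> ((\<lambda>n. (\<Prod>j=1..k. Phi q (\<alpha> j) (\<beta> j) (n j) (u j) (v j)) / (\<Prod>j=1..k. qpoch q q (n j))
            * jackson_integral q x y (\<lambda>z. z ^ (\<Sum>j=1..k. n j) * f z))
        has_sum jackson_integral q x y g) ({1..k} \<rightarrow>\<^sub>E (UNIV :: nat set))"
proof -
  note q = assms(3) and uv = assms(7)
  define c where "c = (\<lambda>n. (\<Prod>j=1..k. Phi q (\<alpha> j) (\<beta> j) (n j) (u j) (v j))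
                              / (\<Prod>j=1..k. qpoch q q (n j)))"
  define G where "G = (\<lambda>z. (\<Prod>j=1..k. qpochs_inf [\<alpha> j * u j * z, \<beta> j * v j * z] q)
                        / (\<Prod>j=1..k. qpochs_inf [z * u j, z * v j] q))"
  have g: "g = (\<lambda>z. G z * f z)"
    by (simp add: g_def f_def G_def fun_eq_iff mult_ac)
  have bounded: "Bseq (\<lambda>m. f (w * q ^ m))" for w
  proof -
    \<comment> \<open>Each argument is brought to the form \<open>r q\<^sup>m\<close>; this remains correct for \<open>x = 0\<close> or
      \<open>y = 0\<close>, where the division by zero makes the coefficient \<open>r\<close> vanish.\<close>
    have arg: "r * (w * q ^ m) / s = (r * w / s) * q ^ m" "r * (w * q ^ m) * s = (r * w * s) * q ^ m"
        "w * q ^ m * s = (w * s) * q ^ m" for r s m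
      by simp_all
    have "(\<lambda>m. f (w * q ^ m)) \<longlonglongrightarrow> (1 * (1 * (1 * 1))) / (1 * (1 * (1 * 1)))"
      unfolding f_def qpochs_inf_def list.map prod_list.Cons prod_list.Nil arg
      by (intro tendsto_divide tendsto_mult tendsto_const qpoch_inf_geometric_tendsto_1 q) simp
    then show ?thesis
      by (intro convergent_imp_Bseq convergentI)
  qed
  have small: "norm (u j * (w * q ^ m)) < 1 \<and> norm (v j * (w * q ^ m)) < 1"
    if "w \<in> {x, y}" "j \<in> {1..k}" for w j m
  proof -
    have "norm (s * (w * q ^ m)) \<le> norm (w * s)" for s
      using q mult_left_mono[of "norm q ^ m" 1 "norm (w * s)"]
      by (simp add: norm_mult norm_power power_le_one mult_ac)
    then show ?thesis
      using uv[OF that(2)] that(1) by (auto intro: le_less_trans)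
  qed
  \<comment> \<open>The case \<open>m = 0\<close> of the previous bound is the endpoint \<open>w\<close> itself.\<close>
  have abs: "(\<lambda>n. norm (c n * w ^ (\<Sum>j=1..k. n j))) summable_on ({1..k} \<rightarrow>\<^sub>E UNIV)"
    if "w \<in> {x, y}" for w
    unfolding c_def using small[OF that, of _ 0]
    by (intro summable_norm_prod_Phi_generating q) auto
  have gen: "((\<lambda>n. c n * (w * q ^ m) ^ (\<Sum>j=1..k. n j)) has_sum G (w * q ^ m)) ({1..k} \<rightarrow>\<^sub>E UNIV)"
    if "w \<in> {x, y}" for w m
    unfolding c_def G_def using small[OF that]
    by (intro prod_Phi_generating_function q) auto
  note J = jackson_integral_generating_function[OF q bounded abs gen]
  show ?thesis
    using J unfolding g c_def by blast
qed

end
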